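(* Let $G$ be a finite abelian group with $|G| \ge 5$ and let $H = \mathcal{B}_{\pm}(G)$. The following statements are equivalent: (1) $|G|$ is even; (2) $\Delta^{\ast}(H)$ contains an even element; (3) $\Delta_1(H)$ contains an even element.
   Context: For a subset $G_0$ of an abelian group $G$, a sequence over $G_0$ is a finite unordered list $S = g_1\cdots g_\ell$ of elements of $G_0$ (repetitions allowed), forming the free commutative monoid over $G_0$ under concatenation. $S$ is a plus-minus weighted zero-sum sequence if $\sum_i \epsilon_i g_i = 0$ for some $\epsilon_i\in\{+1,-1\}$; $\mathcal{B}_{\pm}(G_0)$ is the monoid of these. For a monoid $H$ with trivial unit group: an atom is a non-identity element not a product of two non-identity elements; $\mathsf{L}_H(a)$ is the set of $k$ such that $a$ is a product of $k$ atoms; $\mathcal{L}(H)=\{\mathsf{L}_H(a)\colon a\in H\}$; for finite $L=\{a_0<\dots<a_k\}$, $\Delta(L)=\{a_i-a_{i-1}\}$; $\Delta(H)=\bigcup_a\Delta(\mathsf{L}_H(a))$; a submonoid $S$ is divisor-closed if every divisor in $H$ of an element of $S$ lies in $S$; $\Delta^{\ast}(H)=\{\min\Delta(S)\colon S \text{ divisor-closed submonoid},\ \Delta(S)\ne\emptyset\}$. $\Delta_1(H)$ is the set of all $d\in\mathbb{N}$ such that for every $k\in\mathbb{N}$ there exist $L\in\mathcal{L}(H)$ and $l\in L$ with $L\cap[l, l+kd] = \{l, l+d, \dots, l+kd\}$ (i.e. $\mathcal{L}(H)$ contains sets of lengths containing, as an interval piece, arithmetic progressions with difference $d$ of arbitrary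 length). *)

theory Defs
  imports "HOL-Library.Multiset" "HOL-Library.Cardinality"
begin

text \<open>
  Monoids are written additively: a monoid \<open>H\<close> is a submonoid, given as a set, of a type of
  class \<open>comm_monoid_add\<close>. So the identity is \<open>0\<close>, products are sums, and the sequences over a
  set \<open>G0\<close> are the multisets \<open>S\<close> with \<open>set_mset S \<subseteq> G0\<close>, concatenated by \<open>+\<close>. The definitions below
  are intended for commutative monoids whose only unit is \<open>0\<close>.
\<close>

definition submonoid_of :: "'a::comm_monoid_add set \<Rightarrow> 'a set \<Rightarrow> bool" where
  "submonoid_of S H \<longleftrightarrow> S \<subseteq> H \<and> 0 \<in> S \<and> (\<forall>a\<in>S. \<forall>b\<in>S. a + b \<in> S)"

definition atoms :: "'a::comm_monoid_add set \<Rightarrow> 'a set" where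
  "atoms H = {a \<in> H. a \<noteq> 0 \<and> \<not> (\<exists>b\<in>H. \<exists>c\<in>H. b \<noteq> 0 \<and> c \<noteq> 0 \<and> a = b + c)}"

text \<open>The identity is the empty product of atoms, so \<open>lengths H 0\<close> contains \<open>0\<close>.\<close>

definition lengths :: "'a::comm_monoid_add set \<Rightarrow> 'a \<Rightarrow> nat set" where
  "lengths H a = {size A | A. set_mset A \<subseteq> atoms H \<and> sum_mset A = a}"

definition length_sets :: "'a::comm_monoid_add set \<Rightarrow> nat set set" where
  "length_sets H = lengths H ` H"

text \<open>Differences of successive elements; this makes sense for infinite \<open>L\<close> as well.\<close>

definition succ_distances :: "nat set \<Rightarrow> nat set" where
  "succ_distances L = {b - a | a b. a \<in> L \<and> b \<in> L \<and> a < b \<and> L \<inter> {a<..<b} = {}}"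

definition Delta :: "'a::comm_monoid_add set \<Rightarrow> nat set" where
  "Delta H = (\<Union>a\<in>H. succ_distances (lengths H a))"

text \<open>Divisibility is divisibility in \<open>H\<close>: the cofactor has to lie in \<open>H\<close>, not just in the ambient type.\<close>

definition divisor_closed_submonoid :: "'a::comm_monoid_add set \<Rightarrow> 'a set \<Rightarrow> bool" where
  "divisor_closed_submonoid S H \<longleftrightarrow>
     submonoid_of S H \<and> (\<forall>a\<in>S. \<forall>b\<in>H. (\<exists>c\<in>H. a = b + c) \<longrightarrow> b \<in> S)"

definition Delta_star :: "'a::comm_monoid_add set \<Rightarrow> nat set" where
  "Delta_star H = {(LEAST d. d \<in> Delta S) | S. divisor_closed_submonoid S H \<and> Delta S \<noteq> {}}"

text \<open>
  Here \<open>d\<close> ranges over the positive integers; \<open>d = 0\<close> would satisfy the condition trivially.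
  Allowing \<open>k = 0\<close> is harmless, as the condition then reads \<open>L \<inter> {l} = {l}\<close>.
\<close>

definition Delta_one :: "'a::comm_monoid_add set \<Rightarrow> nat set" where
  "Delta_one H = {d. d > 0 \<and>
     (\<forall>k. \<exists>L\<in>length_sets H. \<exists>l\<in>L. L \<inter> {l..l + k * d} = {l + i * d | i. i \<le> k})}"

text \<open>
  The signs are attached to the individual terms of the sequence, so repeated elements may occur
  with different signs; \<open>\<epsilon> i\<close> is true for the sign \<open>+1\<close> and false for \<open>-1\<close>.
\<close>

definition pm_zero_sum :: "'g::ab_group_add multiset \<Rightarrow> bool" where
  "pm_zero_sum S \<longleftrightarrow>
     (\<exists>gs \<epsilon>. mset gs = S \<and> (\<Sum>i<length gs. if \<epsilon> i then gs ! i else - (gs ! i)) = 0)"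

definition B_pm :: "'g::ab_group_add set \<Rightarrow> 'g multiset set" where
  "B_pm G0 = {S. set_mset S \<subseteq> G0 \<and> pm_zero_sum S}"

end

theory Submission
  imports Defs "HOL.Modules"
begin

text \<open>
  A divisor-closed submonoid \<open>S\<close> satisfies \<open>min \<Delta>(S) = gcd \<Delta>(S)\<close>, and powers of an element whose lengths
  include \<open>x\<close> and \<open>x + min \<Delta>(S)\<close> have arbitrarily long progressions with this difference among their
  lengths; so \<open>\<Delta>\<^sup>*(H) \<subseteq> \<Delta>\<^sub>1(H)\<close>.

  If \<open>|G|\<close> is even, one finds a subset \<open>G0\<close> and weights \<open>w(g) = \<plusminus>1\<close> for \<open>g \<in> G0\<close> such that every atom
  over \<open>G0\<close> has weight \<open>2\<close> modulo \<open>4\<close>. Then the weight of an element determines the parity of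
  all its lengths. If \<open>y \<noteq> 0\<close> has odd order and \<open>h\<close> is an involution, \<open>G0 = {y + h, h}\<close> works;
  otherwise \<open>G\<close> is a \<open>2\<close>-group and one of \<open>{g, 3g}\<close> with \<open>g\<close> of order \<open>8\<close>, \<open>{g, h, 2g + h}\<close> with \<open>g\<close> of
  order \<open>4\<close> and an involution \<open>h \<noteq> 2g\<close>, or \<open>{e1, e2, e3, e1 + e2 + e3}\<close> with independent involutions does.

  If \<open>|G|\<close> is odd and \<open>g \<noteq> 0\<close> has order \<open>n\<close>, then \<open>(g\<^bsup>n\<^esup>)\<^sup>2 = (g\<^sup>2)\<^bsup>n\<^esup>\<close> with \<open>g\<^bsup>n\<^esup>\<close> and \<open>g\<^sup>2\<close> atoms. As there are
  only finitely many atoms, a long factorization repeats one of them often, and this relation then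
  produces two nearby lengths with odd difference \<open>n - 2\<close>. Hence no long progression of lengths
  without gaps in between has an even difference.
\<close>

section \<open>Plus-minus weighted zero-sum sequences\<close>

text \<open>At most one of the two sums is nonempty, since \<open>nat\<close> sends negative
  integers to 0. This is the action of the integers on an abelian group; it is set up in order to
  use the laws of \<open>module\<close>.\<close>

definition imult :: "int \<Rightarrow> 'g::ab_group_add \<Rightarrow> 'g" where
  "imult k x = (\<Sum>i<nat k. x) - (\<Sum>i<nat (- k). x)"

lemma sum_const_add: "(\<Sum>i<m + n::nat. x::'g::ab_group_add) = (\<Sum>i<m. x) + (\<Sum>i<n. x)"
  by (induction n) (auto simp: algebra_simps)

text \<open>Common terms cancel. Because the representation as a difference is arbitrary, additivity
  in the scalar needs no case distinction on signs.\<close>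

lemma imult_diff: "imult (int m - int n) x = (\<Sum>i<m. x) - (\<Sum>i<n. x)"
proof (cases "n \<le> m")
  case True
  then obtain k where "m = n + k"
    using le_Suc_ex by blast
  then show ?thesis by (simp add: imult_def sum_const_add)
next
  case False
  then obtain k where "n = m + k"
    by (metis nat_le_linear le_Suc_ex)
  then show ?thesis by (simp add: imult_def sum_const_add)
qed

interpretation imult: module imult
proof
  show add: "imult (k + l) x = imult k x + imult l x" for k l and x :: 'a
  proof -
    obtain a b where k: "k = int a - int b" by (rule int_diff_cases)
    obtain c d where l: "l = int c - int d" by (rule int_diff_cases)
    have "k + l = int (a + c) - int (b + d)" by (simp add: k l)
    then show ?thesis
      unfolding k l by (simp only: imult_diff sum_const_add) (simp add: algebra_simps)
  qed
  show one: "imult 1 x = x" for x :: 'a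
    by (simp add: imult_def)
  show right: "imult k (x + y) = imult k x + imult k y" for k and x y :: 'a
    by (simp add: imult_def sum.distrib)
  have zero: "imult 0 x = 0" for x :: 'a
    by (simp add: imult_def)
  have minus: "imult (k - 1) x = imult k x - x" for k and x :: 'a
    using add [of "k - 1" 1 x] by (simp add: one)
  show "imult k (imult l x) = imult (k * l) x" for k l and x :: 'a
  proof (induction k rule: int_induct [where k = 0])
    case base
    show ?case by (simp add: zero)
  next
    case (step1 i)
    then show ?case by (simp add: add one distrib_right)
  next
    case (step2 i)
    have "imult (i * l - l) x + imult l x = imult (i * l) x"
      by (simp flip: add)
    then show ?case using step2 by (simp add: minus left_diff_distrib algebra_simps)
  qed
qed

lemma imult_two: "imult 2 x = x + x"
  using imult.scale_left_distrib [of 1 1 x] by simp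

lemma sum_mset_eq_imult:
  fixes M :: "'g::ab_group_add multiset"
  assumes "finite G0" "set_mset M \<subseteq> G0"
  shows "sum_mset M = (\<Sum>x\<in>G0. imult (int (count M x)) x)"
  using assms(2)
proof (induction M)
  case (add y M)
  have "imult (int (count (add_mset y M) x)) x =
      (if x = y then y else 0) + imult (int (count M x)) x" for x
    by (simp add: imult.scale_left_distrib)
  then show ?case
    using add assms(1) by (simp add: sum.distrib sum.delta)
qed simp

lemma sum_replicate_imult:
  fixes x :: "'g::ab_group_add"
  shows "sum_mset (replicate_mset n x) = imult (int n) x"
  by (induction n) (auto simp: imult.scale_left_distrib)

text \<open>The signs split the sequence into the terms taken with + and those taken with -; their
  order is irrelevant.\<close>

lemma pm_zero_sum_iff: "pm_zero_sum S \<longleftrightarrow> (\<exists>P N. S = P + N \<and> sum_mset P = sum_mset N)"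
proof
  assume "pm_zero_sum S"
  then obtain gs \<epsilon> where gs: "mset gs = S"
    and sum: "(\<Sum>i<length gs. if \<epsilon> i then gs ! i else - (gs ! i)) = 0"
    unfolding pm_zero_sum_def by blast
  \<comment> \<open>The claim is generalized to arbitrary signed sums. Induction from the right
    leaves the indices, and so the signs, of earlier terms unchanged.\<close>
  have "\<exists>P N. mset gs = P + N \<and>
      (\<Sum>i<length gs. if \<epsilon> i then gs ! i else - (gs ! i)) = sum_mset P - sum_mset N" for gs :: "'a list"
  proof (induction gs rule: rev_induct)
    case (snoc x gs)
    then obtain P N where PN: "mset gs = P + N"
      "(\<Sum>i<length gs. if \<epsilon> i then gs ! i else - (gs ! i)) = sum_mset P - sum_mset N"
      by blast
    have eq: "(\<Sum>i<length gs. if \<epsilon> i then (gs @ [x]) ! i else - ((gs @ [x]) ! i)) =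
        (\<Sum>i<length gs. if \<epsilon> i then gs ! i else - (gs ! i))"
      by (rule sum.cong) (auto simp: nth_append)
    show ?case
    proof (cases "\<epsilon> (length gs)")
      case True
      then show ?thesis
        using PN eq by (intro exI [of _ "add_mset x P"] exI [of _ N]) (auto simp: algebra_simps)
    next
      case False
      then show ?thesis
        using PN eq by (intro exI [of _ P] exI [of _ "add_mset x N"]) (auto simp: algebra_simps)
    qed
  qed auto
  from this [of gs] gs sum show "\<exists>P N. S = P + N \<and> sum_mset P = sum_mset N"
    by auto
next
  assume "\<exists>P N. S = P + N \<and> sum_mset P = sum_mset N"
  then obtain P N where PN: "S = P + N" "sum_mset P = sum_mset N" by blast
  obtain ps ns where ps: "mset ps = P" and ns: "mset ns = N"
    by (metis ex_mset)
  let ?gs = "ps @ ns" and ?\<epsilon> = "\<lambda>i. i < length ps"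
  have "(\<Sum>i<length ?gs. if ?\<epsilon> i then ?gs ! i else - (?gs ! i)) =
      (\<Sum>i<length ps. ps ! i) + (\<Sum>i<length ns. - (ns ! i))"
  proof -
    \<comment> \<open>Any \<open>n\<close> may replace the length of \<open>ns\<close>, since
      \<open>nth_append\<close> also holds for indices out of range; this makes induction
      possible.\<close>
    have "(\<Sum>i<length ps + n. if ?\<epsilon> i then ?gs ! i else - (?gs ! i)) =
      (\<Sum>i<length ps. ps ! i) + (\<Sum>i<n. - (ns ! i))" for n
      by (induction n) (auto simp: nth_append)
    then show ?thesis by simp
  qed
  also have "\<dots> = sum_mset P - sum_mset N"
    by (simp add: sum_negf ps [symmetric] ns [symmetric] sum_mset_sum_list sum_list_sum_nth
        atLeast0LessThan)
  finally show "pm_zero_sum S"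
    unfolding pm_zero_sum_def using PN ps ns
    by (intro exI [of _ ?gs] exI [of _ ?\<epsilon>]) auto
qed

lemma B_pm_iff:
  "S \<in> B_pm G0 \<longleftrightarrow> set_mset S \<subseteq> G0 \<and> (\<exists>P N. S = P + N \<and> sum_mset P = sum_mset N)"
  by (auto simp: B_pm_def pm_zero_sum_iff)

text \<open>Here \<open>c x\<close> is the number of plus signs minus the number of minus signs on
  the copies of \<open>x\<close>. Membership thus yields a linear relation whose coefficients are
  bounded by the multiplicities and have their parity.\<close>

lemma B_pm_coefficients:
  fixes S :: "'g::ab_group_add multiset"
  assumes "finite G0" "S \<in> B_pm G0"
  obtains c where "\<And>x. \<bar>c x\<bar> \<le> int (count S x)" "\<And>x. even (c x) \<longleftrightarrow> even (count S x)"
    "(\<Sum>x\<in>G0. imult (c x) x) = 0"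
proof -
  from assms(2) obtain P N where PN: "S = P + N" "sum_mset P = sum_mset N" "set_mset S \<subseteq> G0"
    by (auto simp: B_pm_iff)
  let ?c = "\<lambda>x. int (count P x) - int (count N x)"
  have "(\<Sum>x\<in>G0. imult (?c x) x) = 0"
    using PN sum_mset_eq_imult [OF assms(1), of P] sum_mset_eq_imult [OF assms(1), of N]
    by (simp add: imult.scale_left_diff_distrib sum_subtractf)
  then show ?thesis
    by (intro that [of ?c]) (auto simp: PN)
qed

section \<open>Membership in the monoid\<close>

lemma submonoid_B_pm: "submonoid_of (B_pm G0) UNIV"
  unfolding submonoid_of_def
proof (intro conjI ballI)
  show "0 \<in> B_pm G0"
    by (simp add: B_pm_iff)
  fix a b assume "a \<in> B_pm G0" "b \<in> B_pm G0"
  then obtain P N Q M where "a = P + N" "sum_mset P = sum_mset N" "b = Q + M" "sum_mset Q = sum_mset M"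
    and "set_mset a \<subseteq> G0" "set_mset b \<subseteq> G0"
    by (auto simp: B_pm_iff)
  then show "a + b \<in> B_pm G0"
    unfolding B_pm_iff by (intro conjI exI [of _ "P + Q"] exI [of _ "N + M"]) auto
qed simp

lemma B_pm_add: "a \<in> B_pm G0 \<Longrightarrow> b \<in> B_pm G0 \<Longrightarrow> a + b \<in> B_pm G0"
  using submonoid_B_pm by (auto simp: submonoid_of_def)

text \<open>Half of the copies of each element get the sign +, the other half the sign -.\<close>

lemma B_pm_even:
  assumes "set_mset S \<subseteq> G0" "\<And>x. even (count S x)"
  shows "S \<in> B_pm G0"
proof -
  define T where "T = (\<Sum>x\<in>set_mset S. replicate_mset (count S x div 2) x)"
  have "count T x = (if x \<in># S then count S x div 2 else 0)" for x
    by (simp add: T_def count_sum)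
  moreover have "count S x = count S x div 2 + count S x div 2" for x
    using assms(2) [of x] by presburger
  ultimately have "S = T + T"
    by (auto intro!: multiset_eqI simp: not_in_iff)
  then show ?thesis
    using assms(1) unfolding B_pm_iff by blast
qed

lemma B_pm_replicate:
  fixes x :: "'g::ab_group_add"
  assumes "x \<in> G0" "imult (int n) x = 0"
  shows "replicate_mset n x \<in> B_pm G0"
  unfolding B_pm_iff using assms
  by (intro conjI exI [of _ "replicate_mset n x"] exI [of _ "{#}"]) (auto simp: sum_replicate_imult)

lemma B_pm_singleton_iff: "{#x#} \<in> B_pm G0 \<longleftrightarrow> x \<in> G0 \<and> x = 0"
proof
  assume "{#x#} \<in> B_pm G0"
  then obtain P N where PN: "{#x#} = P + N" "sum_mset P = sum_mset N" and "x \<in> G0"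
    by (auto simp: B_pm_iff)
  from PN(1) consider "P = {#x#}" "N = {#}" | "P = {#}" "N = {#x#}"
    by (metis union_is_single)
  then show "x \<in> G0 \<and> x = 0"
    by cases (use PN \<open>x \<in> G0\<close> in auto)
next
  assume "x \<in> G0 \<and> x = 0"
  then show "{#x#} \<in> B_pm G0"
    unfolding B_pm_iff by (intro conjI exI [of _ "{#x#}"] exI [of _ "{#}"]) auto
qed

section \<open>Atoms\<close>

lemma atomsD: "A \<in> atoms H \<Longrightarrow> A \<in> H \<and> A \<noteq> 0"
  by (simp add: atoms_def)

lemma atom_eq_if_divides:
  "A + B \<in> atoms H \<Longrightarrow> A \<in> H \<Longrightarrow> B \<in> H \<Longrightarrow> A \<noteq> 0 \<Longrightarrow> B = 0"
  by (auto simp: atoms_def)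

lemma pair_in_B_pm: "x \<in> G0 \<Longrightarrow> {#x, x#} \<in> B_pm G0"
  by (rule B_pm_even) auto

text \<open>A proper factor would consist of the single term \<open>x\<close>, which is not a
  zero-sum sequence.\<close>

lemma pair_atom:
  assumes "x \<in> G0" "x \<noteq> 0"
  shows "{#x, x#} \<in> atoms (B_pm G0)"
proof -
  have False if "b \<in> B_pm G0" "c \<in> B_pm G0" "b \<noteq> 0" "c \<noteq> 0" "{#x, x#} = b + c" for b c
  proof -
    have "size b + size c = 2"
      using arg_cong [OF that(5), of size] by simp
    moreover have "size b \<noteq> 0" "size c \<noteq> 0"
      using that by auto
    ultimately have "size b = 1"
      by linarith
    then obtain y where "b = {#y#}"
      by (metis size_1_singleton_mset)
    moreover have "y \<in># {#x, x#}"
      unfolding that(5) \<open>b = {#y#}\<close> by simp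
    then have "y = x"
      by simp
    ultimately show False
      using that(1) assms by (simp add: B_pm_singleton_iff)
  qed
  then show ?thesis
    using pair_in_B_pm [OF assms(1)] unfolding atoms_def by auto
qed

text \<open>A term 0 can be removed whatever its sign, so it splits off with a cofactor in the
  monoid.\<close>

lemma atom_with_zero:
  assumes "A \<in> atoms (B_pm G0)" "0 \<in># A"
  shows "A = {#0::'g::ab_group_add#}"
proof -
  obtain C where C: "A = {#0#} + C"
    using assms(2) by (metis add_mset_add_single multi_member_split union_commute)
  have "A \<in> B_pm G0"
    using assms(1) by (simp add: atoms_def)
  then obtain P N where PN: "A = P + N" "sum_mset P = sum_mset N" and G0: "set_mset A \<subseteq> G0"
    unfolding B_pm_iff by blast
  have "C = (P - {#0#}) + N \<or> C = P + (N - {#0#})"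
    using PN(1) C assms(2) by (cases "0 \<in># P") (auto dest!: multi_member_split)
  moreover have "sum_mset (M - {#0#}) = sum_mset M" for M :: "'g multiset"
    by (cases "0 \<in># M") (auto dest!: multi_member_split simp: diff_single_trivial)
  ultimately have "\<exists>P N. C = P + N \<and> sum_mset P = sum_mset N"
    using PN(2) by metis
  then have "C \<in> B_pm G0"
    using G0 C by (auto simp: B_pm_iff)
  then have "C = 0"
    using atom_eq_if_divides [of "{#0#}" C] assms C G0 by (auto simp: B_pm_singleton_iff)
  then show ?thesis using C by simp
qed

section \<open>Sets of lengths\<close>

lemma sum_mset_in_submonoid:
  "submonoid_of H UNIV \<Longrightarrow> set_mset A \<subseteq> H \<Longrightarrow> sum_mset A \<in> H"
  by (induction A) (auto simp: submonoid_of_def)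

lemma lengths_add:
  assumes "x \<in> lengths H a" "y \<in> lengths H b"
  shows "x + y \<in> lengths H (a + b)"
proof -
  from assms obtain A B where "set_mset A \<subseteq> atoms H" "sum_mset A = a" "size A = x"
    "set_mset B \<subseteq> atoms H" "sum_mset B = b" "size B = y"
    by (auto simp: lengths_def)
  then show ?thesis
    unfolding lengths_def by (intro CollectI exI [of _ "A + B"]) auto
qed

lemma lengthsI: "set_mset A \<subseteq> atoms H \<Longrightarrow> size A \<in> lengths H (sum_mset A)"
  by (auto simp: lengths_def)

lemma lengths_zero: "0 \<in> lengths H 0"
  using lengthsI [of "{#}" H] by simp

text \<open>The next element of \<open>L\<close> after \<open>x\<close> is at most
  \<open>y\<close>.\<close>

lemma succ_distances_le:
  assumes "x \<in> L" "y \<in> L" "x < y"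
  obtains d where "d \<in> succ_distances L" "d \<le> y - x"
proof -
  define z where "z = (LEAST z. z \<in> L \<and> x < z)"
  have z: "z \<in> L" "x < z" "z \<le> y"
    unfolding z_def using LeastI [of "\<lambda>z. z \<in> L \<and> x < z" y] Least_le [of "\<lambda>z. z \<in> L \<and> x < z" y] assms
    by auto
  have "L \<inter> {x<..<z} = {}"
    using not_less_Least [of _ "\<lambda>z. z \<in> L \<and> x < z"] unfolding z_def by auto
  then have "z - x \<in> succ_distances L"
    unfolding succ_distances_def using z assms by blast
  then show ?thesis
    using that z by auto
qed

text \<open>All factors in \<open>H\<close> of an element of \<open>S\<close> lie in
  \<open>S\<close>, so both monoids offer the same atoms and the same factorizations. Lengths
  computed in \<open>S\<close> can therefore be read in \<open>H\<close>.\<close>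

lemma lengths_divisor_closed:
  assumes H: "submonoid_of H UNIV" and S: "divisor_closed_submonoid S H" and a: "a \<in> S"
  shows "lengths S a = lengths H a"
proof -
  have SH: "S \<subseteq> H" and sub: "submonoid_of S UNIV"
    using S by (auto simp: divisor_closed_submonoid_def submonoid_of_def)
  have closed: "b \<in> S" if "b + c \<in> S" "b \<in> H" "c \<in> H" for b c
    using S that unfolding divisor_closed_submonoid_def by blast
  have atoms: "atoms S = atoms H \<inter> S"
  proof (intro set_eqI iffI)
    fix x assume x: "x \<in> atoms S"
    have False if "b \<in> H" "c \<in> H" "b \<noteq> 0" "c \<noteq> 0" "x = b + c" for b c
    proof -
      have "b \<in> S" "c \<in> S"
        using closed [of b c] closed [of c b] that x by (auto simp: atoms_def add.commute)
      then show False using that x by (auto simp: atoms_def)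
    qed
    then show "x \<in> atoms H \<inter> S"
      using x SH unfolding atoms_def by blast
  qed (use SH in \<open>auto simp: atoms_def\<close>)
  have "set_mset A \<subseteq> S" if A: "set_mset A \<subseteq> atoms H" "sum_mset A = a" for A
  proof
    fix x assume "x \<in># A"
    then obtain B where B: "A = add_mset x B"
      by (metis multi_member_split)
    have "sum_mset B \<in> H"
      by (rule sum_mset_in_submonoid [OF H]) (use A B in \<open>auto simp: atoms_def\<close>)
    then show "x \<in> S"
      using closed [of x "sum_mset B"] A B a by (auto simp: atoms_def)
  qed
  then show ?thesis
    unfolding lengths_def atoms by auto
qed

text \<open>Take \<open>b\<close> as the sum of \<open>k\<close> copies of \<open>a\<close>,
  factoring \<open>j\<close> of them with length \<open>x + d\<close> and the others with length
  \<open>x\<close>.\<close>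

lemma lengths_multiple:
  assumes "submonoid_of S UNIV" "a \<in> S" "x \<in> lengths S a" "x + d \<in> lengths S a"
  obtains b where "b \<in> S" "\<And>j. j \<le> k \<Longrightarrow> k * x + j * d \<in> lengths S b"
proof -
  have "\<exists>b\<in>S. \<forall>j\<le>k. k * x + j * d \<in> lengths S b"
  proof (induction k)
    case 0
    show ?case
      using assms(1) lengths_zero by (intro bexI [of _ 0]) (auto simp: submonoid_of_def)
  next
    case (Suc k)
    then obtain b where b: "b \<in> S" "\<And>j. j \<le> k \<Longrightarrow> k * x + j * d \<in> lengths S b"
      by blast
    have "Suc k * x + j * d \<in> lengths S (b + a)" if "j \<le> Suc k" for j
    proof (cases "j \<le> k")
      case True
      then show ?thesis
        using lengths_add [OF b(2) assms(3), of j] by (simp add: algebra_simps)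
    next
      case False
      then have "j = Suc k" using that by simp
      then show ?thesis
        using lengths_add [OF b(2) assms(4), of k] by (simp add: algebra_simps)
    qed
    moreover have "b + a \<in> S"
      using assms(1,2) b(1) by (auto simp: submonoid_of_def)
    ultimately show ?case by blast
  qed
  then show ?thesis using that by blast
qed

text \<open>This is why the minimum of \<open>Delta S\<close> is its gcd. If
  \<open>e = q * d + r\<close> with \<open>0 < r < d\<close>, add to \<open>b\<close> the element
  \<open>q\<close> times \<open>a\<close>: using its length \<open>q * x + q * d\<close> against the
  \<open>y\<close> of \<open>b\<close>, and its length \<open>q * x\<close> against
  \<open>y + e\<close>, gives two lengths at distance \<open>r\<close>, hence a successive distance
  below the minimum \<open>d\<close>.\<close>

lemma Min_Delta_dvd:
  assumes S: "submonoid_of S UNIV" and d: "d \<in> Delta S" "\<And>e. e \<in> Delta S \<Longrightarrow> d \<le> e"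
    and b: "b \<in> S" "y \<in> lengths S b" "y + e \<in> lengths S b"
  shows "d dvd e"
proof (rule ccontr)
  assume ndvd: "\<not> d dvd e"
  obtain a x where a: "a \<in> S" "x \<in> lengths S a" "x + d \<in> lengths S a" and "d > 0"
    using d(1) by (force simp: Delta_def succ_distances_def)
  define q where "q = e div d"
  have e: "e = q * d + e mod d" "e mod d < d" "e mod d > 0"
    using \<open>d > 0\<close> ndvd by (auto simp: q_def mod_greater_zero_iff_not_dvd)
  obtain c where c: "c \<in> S" "q * x + q * d \<in> lengths S c" "q * x \<in> lengths S c"
    using lengths_multiple [OF S a, of q] by (metis add_cancel_right_right le_refl mult_0 zero_le)
  have "q * x + q * d + y \<in> lengths S (c + b)" "q * x + (y + e) \<in> lengths S (c + b)"
    using lengths_add c b by metis+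
  then obtain f where f: "f \<in> succ_distances (lengths S (c + b))"
    "f \<le> q * x + (y + e) - (q * x + q * d + y)"
    using succ_distances_le [of "q * x + q * d + y" "lengths S (c + b)" "q * x + (y + e)"] e
    by (metis add.assoc add.commute add_less_cancel_left less_add_same_cancel1)
  have "c + b \<in> S" using S c b by (auto simp: submonoid_of_def)
  then have "f \<in> Delta S" using f by (auto simp: Delta_def)
  then have "d \<le> f" by (rule d(2))
  also have "f \<le> e mod d" using f e by linarith
  finally show False using e by simp
qed

lemma Delta_star_subset_Delta_one:
  assumes H: "submonoid_of H UNIV"
  shows "Delta_star H \<subseteq> Delta_one H"
proof
  fix d assume "d \<in> Delta_star H"
  then obtain S where S: "divisor_closed_submonoid S H" "Delta S \<noteq> {}" "d = (LEAST d. d \<in> Delta S)"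
    by (auto simp: Delta_star_def)
  have d: "d \<in> Delta S" "\<And>e. e \<in> Delta S \<Longrightarrow> d \<le> e"
    using S(2,3) by (auto intro: LeastI Least_le)
  have sub: "submonoid_of S UNIV" and SH: "S \<subseteq> H"
    using S(1) by (auto simp: divisor_closed_submonoid_def submonoid_of_def)
  obtain a x where a: "a \<in> S" "x \<in> lengths S a" "x + d \<in> lengths S a" and "d > 0"
    using d(1) by (force simp: Delta_def succ_distances_def)
  have "\<exists>L\<in>length_sets H. \<exists>l\<in>L. L \<inter> {l..l + k * d} = {l + i * d | i. i \<le> k}" for k
  proof -
    obtain b where b: "b \<in> S" "\<And>j. j \<le> k \<Longrightarrow> k * x + j * d \<in> lengths S b"
      using lengths_multiple [OF sub a] by blast
    have l: "k * x \<in> lengths S b" using b(2) [of 0] by simp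
    \<comment> \<open>No further lengths lie in between, as all lengths of \<open>b\<close> are
      congruent modulo \<open>d\<close>.\<close>
    have "\<exists>i\<le>k. z = k * x + i * d" if z: "z \<in> lengths S b" "k * x \<le> z" "z \<le> k * x + k * d" for z
    proof -
      have "d dvd z - k * x"
        by (rule Min_Delta_dvd [OF sub d b(1) l]) (use z in auto)
      then obtain i where "z - k * x = i * d"
        by (metis dvd_def mult.commute)
      moreover have "i * d \<le> k * d"
        using calculation z by linarith
      then have "i \<le> k"
        using \<open>d > 0\<close> by simp
      ultimately show ?thesis
        using z by (intro exI [of _ i]) auto
    qed
    moreover have "i * d \<le> k * d" if "i \<le> k" for i
      using that by simp
    ultimately have "lengths S b \<inter> {k * x..k * x + k * d} = {k * x + i * d | i. i \<le> k}"
      using b(2) by fastforce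
    moreover have "lengths S b \<in> length_sets H"
      using lengths_divisor_closed [OF H S(1) b(1)] b(1) SH by (auto simp: length_sets_def)
    ultimately show ?thesis using l by blast
  qed
  then show "d \<in> Delta_one H"
    using \<open>d > 0\<close> by (auto simp: Delta_one_def)
qed

lemma divisor_closed_B_pm: "divisor_closed_submonoid (B_pm G0) (B_pm UNIV)"
  using submonoid_B_pm [of G0] unfolding divisor_closed_submonoid_def submonoid_of_def
  by (auto simp: B_pm_def)

section \<open>Groups of even order\<close>

lemma sum_pairs: "(\<Sum>x\<in>#A. {#x, x#}) = A + A"
  by (induction A) auto

lemma in_mset_if_odd_count: "odd (count S x) \<Longrightarrow> x \<in># S"
  by (metis count_eq_zero_iff even_zero)

text \<open>The common argument for all configurations. By \<open>ex\<close>, every atom is either a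
  square of one term, of weight 2 modulo 4 because \<open>w\<close> is odd there, or an
  \<open>A\<close> of size \<open>m\<close> and weight 2 modulo 4. The sequence \<open>A0\<close>
  supplies distinct lengths, so that \<open>Delta\<close> is nonempty, and \<open>x0\<close> serves
  to show that it is an atom.\<close>

lemma even_Delta_star:
  fixes G0 :: "'g::ab_group_add set" and w :: "'g \<Rightarrow> int"
  assumes w: "\<And>x. x \<in> G0 \<Longrightarrow> odd (w x)"
    and A0: "A0 \<in> B_pm G0" "size A0 = m" "odd (count A0 x0)" "m > 2"
    and ex: "\<And>S x. S \<in> B_pm G0 \<Longrightarrow> odd (count S x) \<Longrightarrow>
      \<exists>A\<in>B_pm G0. A \<subseteq># S \<and> size A = m \<and> (\<forall>x. even (count (S - A) x)) \<and> (\<Sum>x\<in>#A. w x) mod 4 = 2"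
  shows "\<exists>d\<in>Delta_star (B_pm (UNIV :: 'g set)). even d"
proof -
  let ?B = "B_pm G0"
  have weight_atom: "(\<Sum>x\<in>#S. w x) mod 4 = 2" if S: "S \<in> atoms ?B" for S
  proof -
    have SB: "S \<in> ?B" "S \<noteq> {#}" and SG: "set_mset S \<subseteq> G0"
      using S by (auto simp: atoms_def B_pm_def)
    \<comment> \<open>The cofactor has even multiplicities, hence lies in the monoid, and must
      vanish because \<open>S\<close> is an atom.\<close>
    have eq: "S = A" if "A \<in> ?B" "A \<subseteq># S" "A \<noteq> {#}" "\<And>x. even (count (S - A) x)" for A
    proof -
      have "S - A \<in> ?B"
        using SG that(4) by (intro B_pm_even) (auto dest: in_diffD)
      moreover have "A + (S - A) = S"
        using that(2) by simp
      ultimately have "S - A = 0"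
        using atom_eq_if_divides [of A "S - A" ?B] S that(1,3) by simp
      then show ?thesis
        using \<open>A + (S - A) = S\<close> by simp
    qed
    show ?thesis
    proof (cases "\<forall>x. even (count S x)")
      case True
      obtain x where x: "x \<in># S"
        using SB by blast
      have "count S x \<ge> 2"
        using x True by (metis count_greater_zero_iff dvd_imp_le)
      then have "{#x, x#} \<subseteq># S"
        by (intro mset_subset_eqI) auto
      moreover have "even (count (S - {#x, x#}) y)" for y
        using True by simp
      ultimately have "S = {#x, x#}"
        using x SG by (intro eq pair_in_B_pm) auto
      moreover have "odd (w x)"
        using x SG w by blast
      ultimately show ?thesis
        by simp presburger
    next
      case False
      then obtain A where A: "A \<in> ?B" "A \<subseteq># S" "size A = m" "\<forall>x. even (count (S - A) x)"
        "(\<Sum>x\<in>#A. w x) mod 4 = 2"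
        using ex [OF SB(1)] by blast
      then have "S = A"
        using A0(4) by (intro eq) auto
      then show ?thesis using A by simp
    qed
  qed
  \<comment> \<open>Weights are additive, so the weight of an element fixes the parity of the number
    of its atoms.\<close>
  have weight: "(\<Sum>x\<in>#sum_mset Z. w x) mod 4 = 2 * int (size Z) mod 4"
    if "set_mset Z \<subseteq> atoms ?B" for Z
    using that
  proof (induction Z)
    case (add S Z)
    then have "(\<Sum>x\<in>#sum_mset Z. w x) mod 4 = 2 * int (size Z) mod 4" "(\<Sum>x\<in>#S. w x) mod 4 = 2"
      using weight_atom by auto
    then have "((\<Sum>x\<in>#S. w x) + (\<Sum>x\<in>#sum_mset Z. w x)) mod 4 = (2 + 2 * int (size Z)) mod 4"
      by (intro mod_add_cong) simp_all
    then show ?case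
      by (simp add: algebra_simps)
  qed simp
  have even_dist: "even e" if "e \<in> Delta ?B" for e
  proof -
    from that obtain a X Y where "set_mset X \<subseteq> atoms ?B" "set_mset Y \<subseteq> atoms ?B"
      and eq: "sum_mset X = a" "sum_mset Y = a" "e = size Y - size X" "size X < size Y"
      unfolding Delta_def succ_distances_def lengths_def by auto
    then have "2 * int (size X) mod 4 = 2 * int (size Y) mod 4"
      using weight [of X] weight [of Y] by simp
    then have "even (int (size Y) - int (size X))"
      by presburger
    then show ?thesis
      using eq by (simp add: even_diff_nat)
  qed
  \<comment> \<open>A factor in which \<open>x0\<close> has odd multiplicity contains some
    \<open>A\<close> of size \<open>m\<close>, which is already the size of \<open>A0\<close>. In
    any splitting of \<open>A0\<close>, one of the two factors is of this kind.\<close>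
  have no_split: "c = 0" if b: "b \<in> ?B" "A0 = b + c" "odd (count b x0)" for b c
  proof -
    obtain A where "A \<subseteq># b" "size A = m"
      using ex [OF b(1,3)] by blast
    then have "size b \<ge> m"
      using size_mset_mono by blast
    moreover have "size A0 = size b + size c"
      using b(2) by simp
    ultimately have "size c = 0"
      using A0(2) by linarith
    then show ?thesis by simp
  qed
  have A0_atom: "A0 \<in> atoms ?B"
  proof -
    have False if bc: "b \<in> ?B" "c \<in> ?B" "b \<noteq> 0" "c \<noteq> 0" "A0 = b + c" for b c
    proof (cases "odd (count b x0)")
      case True
      then show False using no_split [of b c] bc by blast
    next
      case False
      then have "odd (count c x0)"
        using A0(3) bc(5) by simp
      then show False
        using no_split [of c b] bc by (simp add: add.commute)
    qed
    then show ?thesis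
      using A0 unfolding atoms_def by auto
  qed
  have nonzero: "0 \<notin># A0"
  proof
    assume "0 \<in># A0"
    then have "A0 = {#0#}"
      by (rule atom_with_zero [OF A0_atom])
    then show False using A0 by simp
  qed
  \<comment> \<open>\<open>A0 + A0\<close> is a product of two copies of \<open>A0\<close> and also
    of the \<open>m > 2\<close> squares of its terms.\<close>
  let ?L = "lengths ?B (A0 + A0)"
  have "2 \<in> ?L"
    using lengthsI [of "{#A0, A0#}" ?B] A0_atom by (simp add: numeral_2_eq_2)
  moreover have "m \<in> ?L"
  proof -
    have "{#x, x#} \<in> atoms ?B" if "x \<in># A0" for x
      using that nonzero A0(1) by (intro pair_atom) (auto simp: B_pm_def)
    then have "set_mset (image_mset (\<lambda>x. {#x, x#}) A0) \<subseteq> atoms ?B"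
      by auto
    from lengthsI [OF this] show ?thesis
      using A0(2) by (simp add: sum_pairs)
  qed
  ultimately obtain e where "e \<in> succ_distances ?L"
    using succ_distances_le A0(4) by metis
  then have ne: "e \<in> Delta ?B"
    using B_pm_add [OF A0(1) A0(1)] by (auto simp: Delta_def)
  then have "(LEAST d. d \<in> Delta ?B) \<in> Delta ?B"
    by (rule LeastI)
  then have "even (LEAST d. d \<in> Delta ?B)"
    by (rule even_dist)
  moreover have "(LEAST d. d \<in> Delta ?B) \<in> Delta_star (B_pm (UNIV :: 'g set))"
    using divisor_closed_B_pm ne unfolding Delta_star_def by blast
  ultimately show ?thesis by blast
qed

section \<open>Annihilators of torsion elements\<close>

lemma imult_involution:
  assumes "x + x = 0"
  shows "imult k x = (if even k then 0 else x)"
proof (cases "even k")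
  case True
  then obtain j where "k = j * 2" by (metis evenE mult.commute)
  then have "imult k x = imult j (imult 2 x)" by simp
  then show ?thesis using True assms by (simp only: imult_two) simp
next
  case False
  then obtain j where "k = j * 2 + 1" by (metis oddE mult.commute)
  then have "imult k x = imult j (imult 2 x) + x" by (simp add: imult.scale_left_distrib)
  then show ?thesis using False assms by (simp only: imult_two) simp
qed

text \<open>The hypotheses say that \<open>x\<close> has order exactly \<open>2 ^ Suc n\<close>. The
  induction passes to the double of \<open>x\<close>; if the remaining cofactor \<open>j\<close>
  were odd, \<open>k\<close> would act on \<open>x\<close> like half the order.\<close>

lemma imult_power_two_dvd:
  assumes "imult (2 ^ Suc n) x = 0" "imult (2 ^ n) x \<noteq> 0" "imult k x = 0"
  shows "2 ^ Suc n dvd k"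
  using assms
proof (induction n arbitrary: x)
  case 0
  then show ?case
    using imult_involution [of x k] by (auto simp: imult_two split: if_splits)
next
  case (Suc n)
  have two: "imult (2 ^ m) (imult 2 x) = imult (2 ^ Suc m) x" for m
    by (simp add: mult.commute)
  have "imult k (imult 2 x) = imult 2 (imult k x)"
    by (rule imult.scale_left_commute)
  then have "2 ^ Suc n dvd k"
    using Suc.prems by (intro Suc.IH [of "imult 2 x"]) (simp_all only: two imult.scale_zero_right not_False_eq_True)
  then obtain j where j: "k = 2 ^ Suc n * j" ..
  have "even j"
  proof (rule ccontr)
    assume "odd j"
    then obtain i where "j = 2 * i + 1" by (rule oddE)
    then have "k = i * 2 ^ Suc (Suc n) + 2 ^ Suc n"
      by (simp add: j algebra_simps)
    then have "imult k x = imult i (imult (2 ^ Suc (Suc n)) x) + imult (2 ^ Suc n) x"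
      by (simp only: imult.scale_left_distrib imult.scale_scale)
    then show False
      unfolding Suc.prems(1) using Suc.prems by simp
  qed
  then show ?case
    by (auto simp: j)
qed

text \<open>This \<open>n\<close> is the order of \<open>x\<close>, odd as a divisor of
  \<open>q\<close>. The absolute value allows signed coefficients for \<open>k\<close>.\<close>

lemma least_odd_annihilator:
  assumes "odd q" "imult (int q) x = 0"
  obtains n where "odd n" "n \<le> q" "imult (int n) x = 0"
    "\<And>k. odd k \<Longrightarrow> imult k x = 0 \<Longrightarrow> int n \<le> \<bar>k\<bar>"
proof -
  define n where "n = (LEAST n. odd n \<and> imult (int n) x = 0)"
  have n: "odd n \<and> imult (int n) x = 0"
    unfolding n_def by (rule LeastI [of _ q]) (use assms in auto)
  have least: "n \<le> j" if "odd j" "imult (int j) x = 0" for j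
    unfolding n_def by (rule Least_le) (use that in auto)
  have "int n \<le> \<bar>k\<bar>" if "odd k" "imult k x = 0" for k
  proof -
    have "imult \<bar>k\<bar> x = 0"
      using that by (cases "k \<ge> 0") auto
    then show ?thesis
      using least [of "nat \<bar>k\<bar>"] that by (simp add: even_nat_iff)
  qed
  then show ?thesis
    using that n least assms by blast
qed

text \<open>Let \<open>q\<close> be the order of \<open>y\<close> and \<open>g = y + h\<close>. A
  relation between \<open>g\<close> and \<open>h\<close> has coefficients of equal parity and the
  one at \<open>g\<close> annihilates \<open>y\<close>. If they are odd, \<open>g\<close> occurs at
  least \<open>q\<close> times, so \<open>A0\<close>, made of \<open>h\<close> and \<open>q\<close>
  copies of \<open>g\<close>, is contained in the sequence.\<close>

lemma even_Delta_star_odd_torsion: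
  fixes y h :: "'g::ab_group_add"
  assumes h: "h \<noteq> 0" "h + h = 0" and y: "y \<noteq> 0" "odd q0" "imult (int q0) y = 0"
  shows "\<exists>d\<in>Delta_star (B_pm (UNIV :: 'g set)). even d"
proof -
  obtain q where q: "odd q" "imult (int q) y = 0"
    and least: "\<And>k. odd k \<Longrightarrow> imult k y = 0 \<Longrightarrow> int q \<le> \<bar>k\<bar>"
    using least_odd_annihilator [OF y(2,3)] by metis
  have "q \<noteq> 1" using q y by auto
  then have "q > 1" using q(1) by (metis One_nat_def even_zero less_one linorder_neqE_nat)
  define g where "g = y + h"
  have "g \<noteq> h" using y by (simp add: g_def)
  define A0 where "A0 = add_mset h (replicate_mset q g)"
  \<comment> \<open>The sign at \<open>h\<close> is chosen to make the weight \<open>q + w h\<close>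
    of \<open>A0\<close> equal to 2 modulo 4.\<close>
  define w :: "'g \<Rightarrow> int" where "w x = (if x = h \<and> q mod 4 \<noteq> 1 then -1 else 1)" for x
  have A0: "A0 \<in> B_pm {g, h}"
  proof -
    have "sum_mset A0 = h + imult (int q) y + imult (int q) h"
      by (simp add: A0_def sum_replicate_imult g_def imult.scale_right_distrib)
    also have "\<dots> = 0"
      using q h imult_involution [OF h(2), of "int q"] by simp
    finally show ?thesis
      unfolding B_pm_iff by (intro conjI exI [of _ A0] exI [of _ "{#}"]) (auto simp: A0_def)
  qed
  have wA0: "(\<Sum>x\<in>#A0. w x) mod 4 = 2"
  proof -
    have "(\<Sum>x\<in>#A0. w x) = w h + int q"
      using \<open>g \<noteq> h\<close> by (simp add: A0_def w_def)
    moreover have "q mod 4 = 1 \<or> q mod 4 = 3"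
      using q(1) by presburger
    ultimately show ?thesis
      unfolding w_def by (auto split: if_splits) presburger+
  qed
  show ?thesis
  proof (rule even_Delta_star [of "{g, h}" w A0 "q + 1" h])
    fix S x assume S: "S \<in> B_pm {g, h}" and odd: "odd (count S x)"
    obtain c where c: "\<And>x. \<bar>c x\<bar> \<le> int (count S x)" "\<And>x. even (c x) \<longleftrightarrow> even (count S x)"
      and sum: "(\<Sum>x\<in>{g, h}. imult (c x) x) = 0"
      by (rule B_pm_coefficients [OF _ S]) auto
    have sum': "imult (c g) y + imult (c g + c h) h = 0"
      using sum \<open>g \<noteq> h\<close>
      by (simp add: g_def [symmetric] imult.scale_left_distrib)
        (simp add: g_def imult.scale_right_distrib add.assoc)
    \<comment> \<open>Multiplication by the odd \<open>q\<close> kills the part in \<open>y\<close>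
      and keeps the parity of the coefficient of \<open>h\<close>.\<close>
    have "imult (int q) (imult (c g) y + imult (c g + c h) h) =
        imult (c g) (imult (int q) y) + imult (int q * (c g + c h)) h"
      by (simp add: imult.scale_right_distrib mult.commute)
    then have "imult (int q * (c g + c h)) h = 0"
      using sum' q by simp
    then have "even (int q * (c g + c h))"
      using h imult_involution [OF h(2)] by metis
    then have even: "even (c g + c h)"
      using q(1) by simp
    then have cg: "imult (c g) y = 0"
      using sum' imult_involution [OF h(2), of "c g + c h"] by simp
    have "x = g \<or> x = h"
      using odd S by (metis B_pm_iff count_eq_zero_iff even_zero empty_iff insert_iff subsetD)
    then have odd_g: "odd (c g)" "odd (c h)"
      using odd c(2) even by auto
    then have "int q \<le> int (count S g)"
      using least cg c(1) by (meson order_trans)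
    moreover have "odd (count S h)" "odd (count S g)" using odd_g c(2) by auto
    ultimately have "A0 \<subseteq># S"
      using \<open>g \<noteq> h\<close> by (intro mset_subset_eqI) (auto intro: in_mset_if_odd_count simp: A0_def)
    moreover have "even (count (S - A0) z)" for z
    proof -
      have "z \<noteq> g \<Longrightarrow> z \<noteq> h \<Longrightarrow> count S z = 0"
        using S by (auto simp: B_pm_iff not_in_iff [symmetric])
      then show ?thesis
        using \<open>odd (count S h)\<close> \<open>odd (count S g)\<close> \<open>g \<noteq> h\<close> q(1) by (auto simp: A0_def)
    qed
    ultimately show "\<exists>A\<in>B_pm {g, h}. A \<subseteq># S \<and> size A = q + 1 \<and>
        (\<forall>x. even (count (S - A) x)) \<and> (\<Sum>x\<in>#A. w x) mod 4 = 2"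
      using A0 wA0 by (intro bexI [of _ A0]) (auto simp: A0_def)
  qed (use A0 \<open>q > 1\<close> \<open>g \<noteq> h\<close> in \<open>auto simp: A0_def w_def\<close>)
qed

text \<open>With \<open>h = 3g\<close>, relations are the solutions of
  \<open>c g + 3 * c h = 0\<close> modulo 8, so both multiplicities have the same parity. The odd
  case contains \<open>A1\<close> or \<open>A2\<close>, of weights 2 and -2.\<close>

lemma even_Delta_star_order_8:
  fixes g :: "'g::ab_group_add"
  assumes g: "imult 8 g = 0" "imult 4 g \<noteq> 0"
  shows "\<exists>d\<in>Delta_star (B_pm (UNIV :: 'g set)). even d"
proof -
  define h where "h = imult 3 g"
  have dvd: "8 dvd k" if "imult k g = 0" for k
    using imult_power_two_dvd [of 2 g k] g that by simp
  have "g \<noteq> h"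
    using dvd [of 2] imult.scale_left_diff_distrib [of 3 1 g] by (auto simp: h_def)
  define w :: "'g \<Rightarrow> int" where "w x = (if x = h then -1 else 1)" for x
  define A1 A2 where "A1 = {#g, g, g, h#}" and "A2 = {#g, h, h, h#}"
  have A1: "A1 \<in> B_pm {g, h}"
  proof -
    have "g + g + g = h"
      using imult.scale_left_distrib [of 2 1 g] by (simp add: h_def imult_two)
    then show ?thesis
      unfolding B_pm_iff
      by (intro conjI exI [of _ "{#g, g, g#}"] exI [of _ "{#h#}"]) (auto simp: A1_def algebra_simps)
  qed
  have A2: "A2 \<in> B_pm {g, h}"
  proof -
    have "h + h + h = imult 3 h"
      using imult.scale_left_distrib [of 2 1 h] by (simp add: imult_two)
    also have "\<dots> = imult 8 g + g"
      using imult.scale_left_distrib [of 8 1 g] by (simp add: h_def)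
    finally show ?thesis
      unfolding B_pm_iff using g
      by (intro conjI exI [of _ "{#h, h, h#}"] exI [of _ "{#g#}"]) (auto simp: A2_def algebra_simps)
  qed
  show ?thesis
  proof (rule even_Delta_star [of "{g, h}" w A1 4 g])
    fix S x assume S: "S \<in> B_pm {g, h}" and odd: "odd (count S x)"
    obtain c where c: "\<And>x. \<bar>c x\<bar> \<le> int (count S x)" "\<And>x. even (c x) \<longleftrightarrow> even (count S x)"
      and sum: "(\<Sum>x\<in>{g, h}. imult (c x) x) = 0"
      by (rule B_pm_coefficients [OF _ S]) auto
    have "imult (c g + 3 * c h) g = 0"
      using sum \<open>g \<noteq> h\<close> by (simp add: imult.scale_left_distrib mult.commute) (simp add: h_def)
    then have dvd8: "8 dvd c g + 3 * c h" by (rule dvd)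
    have "x = g \<or> x = h"
      using odd S by (metis B_pm_iff count_eq_zero_iff even_zero empty_iff insert_iff subsetD)
    moreover have "even (c g) \<longleftrightarrow> even (c h)" using dvd8 by presburger
    ultimately have odds: "odd (count S g)" "odd (count S h)"
      using odd c(2) by auto
    \<comment> \<open>No combination of 1 and 3 with signs is divisible by 8, so one of the odd
      multiplicities is at least 3.\<close>
    have "\<not> (count S g = 1 \<and> count S h = 1)"
    proof
      assume *: "count S g = 1 \<and> count S h = 1"
      have "c g \<in> {-1, 0, 1}" "c h \<in> {-1, 0, 1}"
        using c(1) [of g] c(1) [of h] * by auto
      then show False
        using dvd8 c(2) [of g] c(2) [of h] * by auto
    qed
    then have "count S g \<ge> 3 \<or> count S h \<ge> 3"
      using odds by presburger
    moreover have "A1 \<subseteq># S" if "count S g \<ge> 3"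
      using that \<open>g \<noteq> h\<close> odd_pos [OF odds(2)] by (intro mset_subset_eqI) (auto simp: A1_def)
    moreover have "A2 \<subseteq># S" if "count S h \<ge> 3"
      using that \<open>g \<noteq> h\<close> odd_pos [OF odds(1)] by (intro mset_subset_eqI) (auto simp: A2_def)
    ultimately have "A1 \<subseteq># S \<or> A2 \<subseteq># S"
      by blast
    moreover have "even (count (S - A1) z)" "even (count (S - A2) z)" for z
    proof -
      have "z \<noteq> g \<Longrightarrow> z \<noteq> h \<Longrightarrow> count S z = 0"
        using S by (auto simp: B_pm_iff not_in_iff [symmetric])
      then show "even (count (S - A1) z)" "even (count (S - A2) z)"
        using odds \<open>g \<noteq> h\<close> by (auto simp: A1_def A2_def)
    qed
    moreover have "(\<Sum>x\<in>#A1. w x) mod 4 = 2" "(\<Sum>x\<in>#A2. w x) mod 4 = 2" "size A1 = 4" "size A2 = 4"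
      using \<open>g \<noteq> h\<close> by (auto simp: A1_def A2_def w_def)
    ultimately show "\<exists>A\<in>B_pm {g, h}. A \<subseteq># S \<and> size A = 4 \<and>
        (\<forall>x. even (count (S - A) x)) \<and> (\<Sum>x\<in>#A. w x) mod 4 = 2"
      using A1 A2 by metis
  qed (use A1 \<open>g \<noteq> h\<close> in \<open>auto simp: A1_def w_def\<close>)
qed

text \<open>As \<open>h\<close> is not a multiple of \<open>g\<close>, a relation among
  \<open>g\<close>, \<open>h\<close>, \<open>k\<close> splits into \<open>c g + 2 * c k = 0\<close>
  modulo 4 and \<open>c h + c k = 0\<close> modulo 2. An odd multiplicity thus occurs at
  \<open>h\<close> and \<open>k\<close> together and forces \<open>g\<close> to occur at least
  twice, which gives \<open>A0\<close>.\<close>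

lemma even_Delta_star_order_4:
  fixes g h :: "'g::ab_group_add"
  assumes g: "imult 4 g = 0" "g + g \<noteq> 0" and h: "h + h = 0" "h \<noteq> 0" "h \<noteq> g + g"
  shows "\<exists>d\<in>Delta_star (B_pm (UNIV :: 'g set)). even d"
proof -
  define k where "k = g + g + h"
  have dvd: "4 dvd j" if "imult j g = 0" for j
    using imult_power_two_dvd [of 1 g j] g that by (simp add: imult_two)
  have "k + k = imult 2 (imult 2 g) + (h + h)"
    by (simp only: k_def imult_two) (simp add: algebra_simps)
  then have kk: "k + k = 0" using g h by simp
  have dist: "g \<noteq> h" "g \<noteq> k" "h \<noteq> k"
    using g h kk by (blast, blast, auto simp: k_def)
  define w :: "'g \<Rightarrow> int" where "w x = (if x = k then -1 else 1)" for x
  define A0 where "A0 = {#g, g, h, k#}"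
  have A0: "A0 \<in> B_pm {g, h, k}"
    unfolding B_pm_iff
    by (intro conjI exI [of _ "{#g, g, h#}"] exI [of _ "{#k#}"]) (auto simp: A0_def k_def algebra_simps)
  show ?thesis
  proof (rule even_Delta_star [of "{g, h, k}" w A0 4 h])
    fix S x assume S: "S \<in> B_pm {g, h, k}" and odd: "odd (count S x)"
    obtain c where c: "\<And>x. \<bar>c x\<bar> \<le> int (count S x)" "\<And>x. even (c x) \<longleftrightarrow> even (count S x)"
      and sum: "(\<Sum>x\<in>{g, h, k}. imult (c x) x) = 0"
      by (rule B_pm_coefficients [OF _ S]) auto
    have "imult (c k) k = imult (c k * 2) g + imult (c k) h"
      by (simp only: k_def imult.scale_right_distrib imult_two [symmetric]) simp
    then have eq: "imult (c g + 2 * c k) g + imult (c h + c k) h = 0"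
      using sum dist by (simp add: imult.scale_left_distrib mult.commute algebra_simps)
    \<comment> \<open>Doubling kills the part in \<open>h\<close> and shows that \<open>c g\<close>
      is even.\<close>
    have "imult 2 (imult (c g + 2 * c k) g + imult (c h + c k) h) =
        imult (2 * (c g + 2 * c k)) g + imult ((c h + c k) * 2) h"
      by (simp add: imult.scale_right_distrib mult.commute)
    then have "imult (2 * (c g + 2 * c k)) g = 0"
      using eq imult_involution [OF h(1), of "(c h + c k) * 2"] by simp
    then have "4 dvd 2 * (c g + 2 * c k)" by (rule dvd)
    then have even_g: "even (c g)" by presburger
    \<comment> \<open>Otherwise \<open>h\<close> would be an even multiple of \<open>g\<close>, that
      is, 0 or \<open>g + g\<close>.\<close>
    have "even (c h + c k)"
    proof (rule ccontr)
      assume "odd (c h + c k)"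
      then have hg: "imult (c g + 2 * c k) g = h"
        using eq imult_involution [OF h(1), of "c h + c k"] h(1) by (metis add_right_imp_eq)
      obtain j where j: "c g + 2 * c k = j * 2"
        using even_g by (metis dvd_def dvd_add dvd_triv_left mult.commute)
      have "(g + g) + (g + g) = 0"
        using g(1) imult.scale_scale [of 2 2 g] by (simp add: imult_two)
      then have "imult j (g + g) \<in> {0, g + g}"
        using imult_involution [of "g + g" j] by auto
      then show False
        using hg h j by (metis imult.scale_scale imult_two insert_iff singletonD)
    qed
    then have hk: "even (c h) \<longleftrightarrow> even (c k)" and "imult (c g + 2 * c k) g = 0"
      using eq imult_involution [OF h(1), of "c h + c k"] by auto
    then have dvd4: "4 dvd c g + 2 * c k" using dvd by blast
    have "x = g \<or> x = h \<or> x = k"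
      using odd S by (metis B_pm_iff count_eq_zero_iff even_zero empty_iff insert_iff subsetD)
    then have odds: "odd (count S h)" "odd (count S k)" "even (count S g)"
      using odd c(2) even_g hk by auto
    then have "odd (c k)" using c(2) by blast
    then have "c g \<noteq> 0" using dvd4 by presburger
    then have "count S g \<ge> 2"
      using c(1) [of g] odds(3) by (metis abs_le_zero_iff dvd_imp_le le_zero_eq neq0_conv of_nat_0)
    then have "A0 \<subseteq># S"
      using dist odds by (auto intro!: mset_subset_eqI intro: in_mset_if_odd_count simp: A0_def)
    moreover have "even (count (S - A0) z)" for z
    proof -
      have "z \<noteq> g \<Longrightarrow> z \<noteq> h \<Longrightarrow> z \<noteq> k \<Longrightarrow> count S z = 0"
        using S by (auto simp: B_pm_iff not_in_iff [symmetric])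
      then show ?thesis
        using odds dist by (auto simp: A0_def)
    qed
    moreover have "(\<Sum>x\<in>#A0. w x) mod 4 = 2"
      using dist by (simp add: A0_def w_def)
    ultimately show "\<exists>A\<in>B_pm {g, h, k}. A \<subseteq># S \<and> size A = 4 \<and>
        (\<forall>x. even (count (S - A) x)) \<and> (\<Sum>x\<in>#A. w x) mod 4 = 2"
      using A0 by (intro bexI [of _ A0]) (auto simp: A0_def)
  qed (use A0 dist in \<open>auto simp: A0_def w_def\<close>)
qed

text \<open>The group is a vector space over the field with two elements, and \<open>e1\<close>,
  \<open>e2\<close>, \<open>e3\<close> are independent. The only nontrivial relation of these with
  their sum \<open>k\<close> involves all four, so an odd multiplicity makes all four odd.\<close>

lemma even_Delta_star_elementary:
  fixes e1 e2 e3 :: "'g::ab_group_add"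
  assumes tors: "\<And>x::'g. x + x = 0"
    and e: "e1 \<noteq> 0" "e2 \<notin> {0, e1}" "e3 \<notin> {0, e1, e2, e1 + e2}"
  shows "\<exists>d\<in>Delta_star (B_pm (UNIV :: 'g set)). even d"
proof -
  have eqI: "x = y" if "x + y = 0" for x y :: 'g
    using that tors [of y] by (metis add_right_imp_eq)
  have indep: "e1 \<noteq> 0" "e2 \<noteq> 0" "e3 \<noteq> 0" "e1 + e2 \<noteq> 0" "e1 + e3 \<noteq> 0" "e2 + e3 \<noteq> 0"
    "e1 + e2 + e3 \<noteq> 0"
    using e eqI [of e2 e3] eqI [of e1 e3] eqI [of e1 e2] eqI [of "e1 + e2" e3] by blast+
  define k where "k = e1 + e2 + e3"
  have "k = e1 + (e2 + e3)" "k = e2 + (e1 + e3)" "k = e3 + (e1 + e2)"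
    by (simp_all add: k_def add_ac)
  then have "k \<noteq> e1" "k \<noteq> e2" "k \<noteq> e3"
    using indep by (metis add_cancel_right_right)+
  then have dist: "e1 \<noteq> e2" "e1 \<noteq> e3" "e2 \<noteq> e3" "k \<noteq> e1" "k \<noteq> e2" "k \<noteq> e3"
    using e by blast+
  define w :: "'g \<Rightarrow> int" where "w x = (if x = k then -1 else 1)" for x
  define A0 where "A0 = {#e1, e2, e3, k#}"
  let ?G = "{e1, e2, e3, k}"
  have A0: "A0 \<in> B_pm ?G"
    unfolding B_pm_iff
    by (intro conjI exI [of _ "{#e1, e2, e3#}"] exI [of _ "{#k#}"]) (auto simp: A0_def k_def algebra_simps)
  show ?thesis
  proof (rule even_Delta_star [of ?G w A0 4 e1])
    fix S x assume S: "S \<in> B_pm ?G" and odd: "odd (count S x)"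
    obtain c where c: "\<And>x. \<bar>c x\<bar> \<le> int (count S x)" "\<And>x. even (c x) \<longleftrightarrow> even (count S x)"
      and sum: "(\<Sum>x\<in>?G. imult (c x) x) = 0"
      by (rule B_pm_coefficients [OF _ S]) auto
    have "imult (c k) k = imult (c k) e1 + imult (c k) e2 + imult (c k) e3"
      by (simp only: k_def imult.scale_right_distrib)
    then have eq: "imult (c e1 + c k) e1 + imult (c e2 + c k) e2 + imult (c e3 + c k) e3 = 0"
      using sum dist by (simp add: imult.scale_left_distrib algebra_simps)
    have "even (c e1 + c k) \<and> even (c e2 + c k) \<and> even (c e3 + c k)"
      using eq indep unfolding imult_involution [OF tors]
      by (cases "even (c e1 + c k)"; cases "even (c e2 + c k)"; cases "even (c e3 + c k)") simp_all
    moreover have "x = e1 \<or> x = e2 \<or> x = e3 \<or> x = k"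
      using odd S by (metis B_pm_iff count_eq_zero_iff even_zero empty_iff insert_iff subsetD)
    ultimately have odds: "odd (count S e1)" "odd (count S e2)" "odd (count S e3)" "odd (count S k)"
      using odd c(2) by auto
    then have "A0 \<subseteq># S"
      using dist by (auto intro!: mset_subset_eqI intro: in_mset_if_odd_count simp: A0_def)
    moreover have "even (count (S - A0) z)" for z
    proof -
      have "z \<notin> ?G \<Longrightarrow> count S z = 0"
        using S by (auto simp: B_pm_iff not_in_iff [symmetric])
      then show ?thesis
        using odds dist by (auto simp: A0_def)
    qed
    moreover have "(\<Sum>x\<in>#A0. w x) mod 4 = 2"
      using dist by (simp add: A0_def w_def)
    ultimately show "\<exists>A\<in>B_pm ?G. A \<subseteq># S \<and> size A = 4 \<and>
        (\<forall>x. even (count (S - A) x)) \<and> (\<Sum>x\<in>#A. w x) mod 4 = 2"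
      using A0 by (intro bexI [of _ A0]) (auto simp: A0_def)
  qed (use A0 dist in \<open>auto simp: A0_def w_def\<close>)
qed

section \<open>Finding a configuration in a group of even order\<close>

lemma sum_const_imult: "finite A \<Longrightarrow> (\<Sum>y\<in>A. x) = imult (int (card A)) x"
  by (induction A rule: finite_induct) (auto simp: imult.scale_left_distrib)

text \<open>Translation by \<open>x\<close> permutes the group, so the sum of all elements does not
  change when \<open>x\<close> is added to each of them.\<close>

lemma imult_CARD: "imult (int CARD('g)) (x::'g::{finite, ab_group_add}) = 0"
proof -
  have "(\<Sum>y\<in>UNIV. y + x) = (\<Sum>y\<in>UNIV. y)"
    by (rule sum.reindex_bij_witness [of _ "\<lambda>y. y - x" "\<lambda>y. y + x"]) auto
  then show ?thesis
    by (simp add: sum.distrib sum_const_imult)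
qed

text \<open>Without involutions the nonzero elements fall into pairs of an element and its negative,
  and the order would be odd.\<close>

lemma ex_involution:
  assumes "even CARD('g::{finite, ab_group_add})"
  obtains h :: "'g::{finite, ab_group_add}" where "h \<noteq> 0" "h + h = 0"
proof -
  have "\<exists>h::'g. h \<noteq> 0 \<and> h + h = 0"
  proof (rule ccontr)
    assume none: "\<not> ?thesis"
    define C where "C = (\<lambda>x::'g. {x, - x}) ` (UNIV - {0})"
    have card: "card {x, - x} = 2" if "x \<noteq> 0" for x :: 'g
    proof -
      have "x \<noteq> - x"
        using none that by (metis add.left_inverse add_eq_0_iff)
      then show ?thesis by simp
    qed
    have "2 * card C = card (\<Union>C)"
    proof (rule card_partition)
      show "card c = 2" if "c \<in> C" for c
        using that card by (auto simp: C_def)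
      show "c1 \<inter> c2 = {}" if "c1 \<in> C" "c2 \<in> C" "c1 \<noteq> c2" for c1 c2
        using that by (auto simp: C_def)
    qed auto
    moreover have "\<Union>C = UNIV - {0}"
      by (auto simp: C_def)
    ultimately have "2 * card C = CARD('g) - 1"
      by (simp add: card_Diff_subset)
    moreover have "CARD('g) > 0"
      by (rule zero_less_card_finite)
    ultimately show False
      using assms by presburger
  qed
  then show ?thesis using that by blast
qed

lemma odd_part_decomposition:
  assumes "(n::nat) > 0"
  obtains s q where "n = 2 ^ s * q" "odd q"
proof -
  have "\<exists>s q. n = 2 ^ s * q \<and> odd q"
    using assms
  proof (induction n rule: less_induct)
    case (less n)
    show ?case
    proof (cases "even n")
      case True
      then obtain m where m: "n = 2 * m" by blast
      then obtain s q where "m = 2 ^ s * q" "odd q"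
        using less.IH [of m] less.prems by auto
      then show ?thesis
        using m by (intro exI [of _ "Suc s"] exI [of _ q]) auto
    next
      case False
      then show ?thesis
        by (intro exI [of _ 0] exI [of _ n]) simp
    qed
  qed
  then show ?thesis using that by blast
qed

lemma ex_notin_small:
  assumes "CARD('g::finite) \<ge> 5" "card (A::'g set) \<le> 4"
  obtains x :: "'g::finite" where "x \<notin> A"
proof -
  have "A \<noteq> UNIV"
    using assms by auto
  then show ?thesis using that by blast
qed

lemma even_Delta_star_if_even_CARD:
  assumes card: "CARD('g::{finite, ab_group_add}) \<ge> 5" and even: "even CARD('g)"
  shows "\<exists>d\<in>Delta_star (B_pm (UNIV :: 'g set)). even d"
proof -
  obtain h :: 'g where h: "h \<noteq> 0" "h + h = 0"
    using ex_involution [OF even] by blast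
  obtain s q where sq: "CARD('g) = 2 ^ s * q" "odd q"
    using odd_part_decomposition [of "CARD('g)"] by auto
  \<comment> \<open>If \<open>2 ^ s\<close> does not annihilate the group, some nonzero
    \<open>2 ^ s\<close> multiple is killed by the odd \<open>q\<close>. Otherwise the exponent is a
    power of 2: at least 8, equal to 4, or 2.\<close>
  consider (odd_torsion) x :: 'g where "imult (2 ^ s) x \<noteq> 0"
    | (order_8) x :: 'g where "imult (2 ^ s) x = 0" "imult 4 x \<noteq> 0"
    | (order_4) g :: 'g where "\<And>x::'g. imult 4 x = 0" "g + g \<noteq> 0"
    | (elementary) "\<And>x::'g. x + x = 0"
    by metis
  then show ?thesis
  proof cases
    case odd_torsion
    have "imult (int q) (imult (2 ^ s) x) = imult (int CARD('g)) x"
      unfolding sq(1) by (simp add: mult.commute)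
    then show ?thesis
      using even_Delta_star_odd_torsion [OF h odd_torsion sq(2)] by (simp add: imult_CARD)
  next
    case order_8
    \<comment> \<open>The order of \<open>x\<close> is \<open>2 ^ k\<close> with
      \<open>k > 2\<close>, so its multiple by \<open>2 ^ (k - 3)\<close> has order 8.\<close>
    define k where "k = (LEAST k. imult (2 ^ k) x = 0)"
    have k: "imult (2 ^ k) x = 0"
      unfolding k_def by (rule LeastI [of _ s]) (rule order_8(1))
    have "k > 2"
    proof (rule ccontr)
      assume "\<not> k > 2"
      then have "(4::int) = 2 ^ (2 - k) * 2 ^ k"
        by (simp flip: power_add)
      then have "imult 4 x = imult (2 ^ (2 - k)) (imult (2 ^ k) x)"
        by simp
      then show False using k order_8(2) by simp
    qed
    then obtain j where j: "k = j + 3"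
      by (metis add.commute less_eqE Suc_leI numeral_3_eq_3 numeral_2_eq_2)
    have "imult (2 ^ (j + 2)) x \<noteq> 0"
      using not_less_Least [of "j + 2" "\<lambda>k. imult (2 ^ k) x = 0"] j unfolding k_def by auto
    moreover have "imult (4 * i) (imult (2 ^ j) x) = imult (i * 2 ^ (j + 2)) x" for i
      by (simp add: power_add algebra_simps)
    from this [of 1] this [of 2] have "imult 4 (imult (2 ^ j) x) = imult (2 ^ (j + 2)) x"
      "imult 8 (imult (2 ^ j) x) = imult (2 ^ k) x"
      by (simp_all add: j power_add algebra_simps)
    ultimately show ?thesis
      using even_Delta_star_order_8 [of "imult (2 ^ j) x"] k by simp
  next
    case order_4
    \<comment> \<open>If \<open>g + g\<close> were the only involution, every \<open>x + x\<close>
      would be 0 or \<open>g + g\<close>, so \<open>x\<close> or \<open>x - g\<close> would be 0 or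
      \<open>g + g\<close>. That leaves at most four elements.\<close>
    have "\<exists>h::'g. h + h = 0 \<and> h \<noteq> 0 \<and> h \<noteq> g + g"
    proof (rule ccontr)
      assume none: "\<not> ?thesis"
      have "x \<in> {0, g + g, g, g + g + g}" for x
      proof -
        have "(x + x) + (x + x) = 0"
          using order_4(1) [of x] imult.scale_scale [of 2 2 x] by (simp add: imult_two)
        then have "x + x = 0 \<or> x + x = g + g"
          using none by blast
        moreover have "(x - g) + (x - g) = 0" if "x + x = g + g"
          using that by (simp add: algebra_simps)
        ultimately have "x \<in> {0, g + g} \<or> x - g \<in> {0, g + g}"
          using none by blast
        then show ?thesis by (auto simp: algebra_simps)
      qed
      moreover have "card {0, g + g, g, g + g + g} \<le> 4"
        by (simp add: card_insert_if)
      ultimately show False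
        using ex_notin_small [OF card] by metis
    qed
    then show ?thesis
      using even_Delta_star_order_4 order_4 by blast
  next
    case elementary
    \<comment> \<open>The involution \<open>h\<close> serves as \<open>e1\<close>; five elements
      suffice to leave the span of two.\<close>
    obtain e2 where e2: "e2 \<notin> {0, h}"
      using ex_notin_small [OF card, of "{0, h}"] h by (force simp: card_insert_if)
    obtain e3 where e3: "e3 \<notin> {0, h, e2, h + e2}"
    proof (rule ex_notin_small [OF card])
      show "card {0, h, e2, h + e2} \<le> 4"
        by (simp add: card_insert_if)
    qed
    show ?thesis
      by (rule even_Delta_star_elementary [OF elementary h(1) e2 e3])
  qed
qed

section \<open>Groups of odd order\<close>

text \<open>If \<open>x\<close> occurs with both signs, its square splits off and is the whole atom.
  Otherwise all copies have the same sign, and as many of them as the group has elements split off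
  with sum 0.\<close>

lemma atom_count_le:
  fixes A :: "'g::{finite, ab_group_add} multiset"
  assumes A: "A \<in> atoms (B_pm UNIV)" and card: "CARD('g) \<ge> 2"
  shows "count A x \<le> CARD('g)"
proof (rule ccontr)
  let ?n = "CARD('g)"
  assume "\<not> count A x \<le> ?n"
  then have gt: "count A x > ?n" by simp
  obtain P N where PN: "A = P + N" "sum_mset P = sum_mset N"
    using A by (auto simp: atoms_def B_pm_iff)
  \<comment> \<open>Stated for arbitrary \<open>P\<close> and \<open>N\<close>, so that it also
    applies with their roles exchanged.\<close>
  have one_sided: False if PN: "A = P + N" "sum_mset P = sum_mset N" and x: "x \<notin># N" for P N
  proof -
    have "count P x > ?n"
      using gt PN(1) x by (simp add: not_in_iff)
    then have "replicate_mset ?n x \<subseteq># P"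
      by (simp flip: count_le_replicate_mset_subset_eq)
    then obtain P' where P': "P = replicate_mset ?n x + P'"
      by (metis subset_mset.le_iff_add)
    have "sum_mset P' = sum_mset N"
      using PN(2) P' by (simp add: sum_replicate_imult imult_CARD)
    then have "P' + N \<in> B_pm UNIV"
      by (auto simp: B_pm_iff)
    moreover have "replicate_mset ?n x \<in> B_pm UNIV"
      by (rule B_pm_replicate) (auto simp: imult_CARD)
    ultimately have "P' + N = 0"
      using atom_eq_if_divides [of "replicate_mset ?n x" "P' + N" "B_pm UNIV"] A PN(1) P'
      by (simp add: add.assoc)
    then show False
      using \<open>count P x > ?n\<close> P' by simp
  qed
  show False
  proof (cases "x \<in># P \<and> x \<in># N")
    case True
    then obtain P' N' where P': "P = add_mset x P'" "N = add_mset x N'"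
      by (metis multi_member_split)
    then have "P' + N' \<in> B_pm UNIV"
      using PN by (auto simp: B_pm_iff)
    then have "P' + N' = 0"
      using atom_eq_if_divides [of "{#x, x#}" "P' + N'" "B_pm UNIV"] A PN(1) P' pair_in_B_pm [of x UNIV]
      by simp
    then show False
      using gt card PN(1) P' by simp
  next
    case False
    then show False
      using one_sided [of P N] one_sided [of N P] PN by (auto simp: add.commute)
  qed
qed

lemma atom_size_le:
  fixes A :: "'g::{finite, ab_group_add} multiset"
  assumes "A \<in> atoms (B_pm UNIV)" "CARD('g) \<ge> 2"
  shows "size A \<le> CARD('g) * CARD('g)"
proof -
  have "size A = (\<Sum>x\<in>set_mset A. count A x)"
    by (rule size_multiset_overloaded_eq)
  also have "\<dots> \<le> (\<Sum>x\<in>UNIV. count A x)"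
    by (rule sum_mono2) auto
  also have "\<dots> \<le> (\<Sum>x\<in>(UNIV::'g set). CARD('g))"
    by (rule sum_mono) (rule atom_count_le [OF assms])
  finally show ?thesis by simp
qed

lemma finite_atoms:
  assumes "CARD('g::{finite, ab_group_add}) \<ge> 2"
  shows "finite (atoms (B_pm (UNIV :: 'g set)))"
proof (rule finite_subset)
  show "atoms (B_pm (UNIV :: 'g set)) \<subseteq> (\<Union>n\<le>CARD('g) * CARD('g). multisets_of_size UNIV n)"
    using atom_size_le [OF _ assms] by (auto simp: multisets_of_size_def)
qed auto

text \<open>Signs on an odd number \<open>j\<close> of copies of \<open>x\<close> with sum 0 give an
  odd annihilator of absolute value at most \<open>j\<close>, hence \<open>j >= n\<close>. In a
  splitting of the odd \<open>n\<close>, one part is odd and too short.\<close>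

lemma odd_replicate_atom:
  fixes x :: "'g::ab_group_add"
  assumes n: "odd n" "imult (int n) x = 0"
    and least: "\<And>k. odd k \<Longrightarrow> imult k x = 0 \<Longrightarrow> int n \<le> \<bar>k\<bar>"
  shows "replicate_mset n x \<in> atoms (B_pm UNIV)"
proof -
  have long: "n \<le> j" if "odd j" "replicate_mset j x \<in> B_pm UNIV" for j
  proof -
    have "replicate_mset j x \<in> B_pm {x}"
      using that(2) by (auto simp: B_pm_def)
    then obtain c where c: "\<And>y. \<bar>c y\<bar> \<le> int (count (replicate_mset j x) y)"
      "\<And>y. even (c y) \<longleftrightarrow> even (count (replicate_mset j x) y)" "(\<Sum>y\<in>{x}. imult (c y) y) = 0"
      by (rule B_pm_coefficients [rotated]) auto
    then have "int n \<le> \<bar>c x\<bar>"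
      using least [of "c x"] c(2) [of x] that(1) by simp
    then show "n \<le> j"
      using c(1) [of x] by simp
  qed
  have False if bc: "b \<in> B_pm UNIV" "c \<in> B_pm UNIV" "b \<noteq> 0" "c \<noteq> 0" "replicate_mset n x = b + c" for b c
  proof -
    have "b \<subseteq># replicate_mset n x" "c \<subseteq># replicate_mset n x"
      by (auto simp: bc(5))
    then obtain i j where ij: "b = replicate_mset i x" "c = replicate_mset j x"
      by (meson msubseteq_replicate_msetE)
    then have "n = i + j" "i > 0" "j > 0"
      using arg_cong [OF bc(5), of size] bc(3,4) by auto
    then show False
      using long [of i] long [of j] bc(1,2) ij n(1) by auto
  qed
  moreover have "replicate_mset n x \<noteq> 0"
    using n(1) by (intro notI) simp
  ultimately show ?thesis
    using B_pm_replicate [of x UNIV n] n(2) by (auto simp: atoms_def)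
qed

text \<open>Only the atom \<open>{#0#}\<close> contains 0. Hence it occurs equally often in all
  factorizations of an element, which bounds its occurrences by the smallest length.\<close>

lemma count_zero_sum_atoms:
  assumes "set_mset Z \<subseteq> atoms (B_pm (UNIV :: 'g::ab_group_add set))"
  shows "count (sum_mset Z) 0 = count Z {#0#}"
  using assms
proof (induction Z)
  case (add A Z)
  have "count A 0 = (if A = {#0#} then 1 else 0)"
  proof (cases "A = {#0#}")
    case False
    then have "0 \<notin># A"
      using add.prems atom_with_zero [of A UNIV] by force
    then show ?thesis
      using False by (simp add: count_eq_zero_iff)
  qed simp
  moreover have "count (sum_mset Z) 0 = count Z {#0#}"
    using add by simp
  ultimately show ?case
    by simp
qed simp

section \<open>Repeated atoms and the exchange relation\<close>

lemma size_le_card_times: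
  assumes "finite A" "set_mset Z \<subseteq> A" "\<And>x. x \<in> A \<Longrightarrow> count Z x \<le> m"
  shows "size Z \<le> card A * m"
proof -
  have "size Z = (\<Sum>x\<in>set_mset Z. count Z x)"
    by (rule size_multiset_overloaded_eq)
  also have "\<dots> \<le> (\<Sum>x\<in>A. count Z x)"
    using assms by (intro sum_mono2) auto
  also have "\<dots> \<le> card A * m"
    using sum_mono [of A "count Z" "\<lambda>_. m"] assms(3) by simp
  finally show ?thesis .
qed

lemma sum_mset_replicate_pairs:
  "(\<Sum>y\<in>#A. sum_mset (replicate_mset n {#y, y#})) = sum_mset (replicate_mset (2 * n) A)"
proof (induction A)
  case (add y A)
  have "sum_mset (replicate_mset (2 * n) (add_mset y A)) =
      sum_mset (replicate_mset n {#y, y#}) + sum_mset (replicate_mset (2 * n) A)"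
    by (induction n) auto
  then show ?case using add by simp
qed (induction n, auto)

lemma sum_mset_replicate_pair:
  "sum_mset (replicate_mset n {#y, y#}) = replicate_mset n y + replicate_mset n y"
  by (induction n) auto

text \<open>
  Replace \<open>2n\<close> copies of \<open>A\<close> by \<open>n\<close> copies of \<open>y\<^sup>2\<close> for each term \<open>y\<close> of \<open>A\<close>; for one term \<open>g\<close> these
  \<open>n\<close> atoms can be exchanged for two copies of the atom \<open>g\<^bsup>n\<^esup>\<close>, a change of length by the odd
  number \<open>n - 2\<close>.
\<close>

lemma odd_length_change:
  fixes Z :: "'g::{finite, ab_group_add} multiset multiset"
  assumes odd: "odd CARD('g)" and card: "CARD('g) \<ge> 2"
    and Z: "set_mset Z \<subseteq> atoms (B_pm UNIV)"
    and A: "count Z A \<ge> 2 * CARD('g)" "A \<noteq> {#0#}"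
  obtains r n where "r \<in> lengths (B_pm UNIV) (sum_mset Z)" "r + n \<in> lengths (B_pm UNIV) (sum_mset Z)"
    "odd n" "size Z \<le> r + CARD('g)" "r + n \<le> size Z + CARD('g) * (CARD('g) * CARD('g))"
proof -
  let ?N = "CARD('g)" and ?H = "B_pm (UNIV :: 'g set)"
  have "A \<in># Z"
    using A(1) card by (intro count_inI) auto
  then have AH: "A \<in> atoms ?H" using Z by blast
  have nonzero: "0 \<notin># A"
    using atom_with_zero [OF AH] A(2) by blast
  obtain g A' where g: "A = add_mset g A'"
    using AH by (metis atomsD multiset_cases zero_multiset_def)
  have "g \<noteq> 0" using nonzero g by auto
  have "A' \<noteq> {#}"
    using AH g \<open>g \<noteq> 0\<close> by (auto simp: atoms_def B_pm_singleton_iff)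
  obtain n where n: "odd n" "n \<le> ?N" "imult (int n) g = 0"
    "\<And>k. odd k \<Longrightarrow> imult k g = 0 \<Longrightarrow> int n \<le> \<bar>k\<bar>"
    using least_odd_annihilator [OF odd imult_CARD [of g]] by blast
  have "n \<noteq> 1" using n(3) \<open>g \<noteq> 0\<close> by auto
  then have "n \<ge> 3" using n(1) by presburger
  have "replicate_mset (2 * n) A \<subseteq># Z"
    using A(1) n(2) by (simp flip: count_le_replicate_mset_subset_eq)
  then obtain Z' where Z': "Z = replicate_mset (2 * n) A + Z'"
    by (metis subset_mset.le_iff_add)
  \<comment> \<open>The part shared by both new factorizations. It omits the contribution of
    \<open>g\<close>, which is completed either by two copies of the atom of \<open>n\<close> terms
    \<open>g\<close> or by \<open>n\<close> copies of the square of \<open>g\<close>.\<close>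
  define Y where "Y = Z' + (\<Sum>y\<in>#A'. replicate_mset n {#y, y#})"
  have sumA': "sum_mset (\<Sum>y\<in>#A'. replicate_mset n {#y, y#}) = (\<Sum>y\<in>#A'. sum_mset (replicate_mset n {#y, y#}))"
    by (induction A') auto
  have sumY: "sum_mset Y + (replicate_mset n g + replicate_mset n g) = sum_mset Z"
    using sum_mset_replicate_pairs [of n A]
    by (simp add: Y_def Z' g sumA' sum_mset_replicate_pair add_ac)
  have Y: "set_mset Y \<subseteq> atoms ?H"
  proof -
    have "{#y, y#} \<in> atoms ?H" if "y \<in># A'" for y
      using that nonzero g by (intro pair_atom) auto
    then show ?thesis
      using Z Z' unfolding Y_def by auto
  qed
  have sizeY: "size Y = size Z' + size A' * n"
    unfolding Y_def by (induction A') auto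
  have sizeZ: "size Z = size Z' + 2 * n"
    by (simp add: Z')
  have sizeA': "1 \<le> size A'" "size A' \<le> ?N * ?N"
    using \<open>A' \<noteq> {#}\<close> atom_size_le [OF AH card] g by (auto simp: Suc_le_eq nonempty_has_size)
  have "sum_mset (Y + {#replicate_mset n g, replicate_mset n g#}) = sum_mset Z"
    unfolding sumY [symmetric] by (simp add: add_ac)
  then have "size Y + 2 \<in> lengths ?H (sum_mset Z)"
    using lengthsI [of "Y + {#replicate_mset n g, replicate_mset n g#}" ?H] Y
      odd_replicate_atom [OF n(1,3,4)] by simp
  moreover have "size Y + n \<in> lengths ?H (sum_mset Z)"
    using lengthsI [of "Y + replicate_mset n {#g, g#}" ?H] Y sumY pair_atom [OF UNIV_I \<open>g \<noteq> 0\<close>] \<open>n \<ge> 3\<close>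
    by (simp add: sum_mset_replicate_pair)
  \<comment> \<open>Since \<open>A'\<close> has at least one term, the exchange shortens the
    factorization by less than \<open>n\<close>.\<close>
  moreover have "size Z' + n \<le> size Y"
    using sizeY sizeA'(1) by simp
  moreover have "size Y + n \<le> size Z + ?N * (?N * ?N)"
  proof -
    have "size A' * n \<le> (?N * ?N) * ?N"
      using sizeA' n(2) by (intro mult_mono) auto
    then show ?thesis using sizeY sizeZ by simp
  qed
  moreover have "size Y + 2 + (n - 2) = size Y + n"
    using \<open>n \<ge> 3\<close> by simp
  ultimately show ?thesis
    using \<open>n \<ge> 3\<close> n(1,2) sizeZ by (intro that [of "size Y + 2" "n - 2"]) (simp_all only:, auto)
qed

lemma odd_Delta_one:
  assumes odd: "odd CARD('g::{finite, ab_group_add})" and card: "CARD('g) \<ge> 2"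
    and d: "d \<in> Delta_one (B_pm (UNIV :: 'g set))"
  shows "odd d"
proof
  assume "even d"
  let ?N = "CARD('g)" and ?H = "B_pm (UNIV :: 'g set)"
  \<comment> \<open>A factorization of length \<open>l + K * d\<close> exceeds the pigeonhole bound
    even without its at most \<open>l\<close> factors \<open>{#0#}\<close>. The summand
    \<open>?N\<close> of \<open>K\<close> leaves room below for the shortening by the exchange, and
    \<open>M\<close> leaves room above for the lengthening.\<close>
  define K where "K = card (atoms ?H) * (2 * ?N) + ?N + 1"
  define M where "M = ?N * (?N * ?N)"
  have "d > 0" using d by (simp add: Delta_one_def)
  obtain L l where L: "L \<in> length_sets ?H" and l: "l \<in> L"
    and AP: "L \<inter> {l..l + (K + M) * d} = {l + i * d | i. i \<le> K + M}"
    using d unfolding Delta_one_def by blast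
  obtain a where a: "L = lengths ?H a"
    using L by (auto simp: length_sets_def)
  have "l + K * d \<in> L"
    using AP by (metis (mono_tags, lifting) IntD1 le_add1 mem_Collect_eq)
  then obtain Z where Z: "set_mset Z \<subseteq> atoms ?H" "sum_mset Z = a" "size Z = l + K * d"
    by (auto simp: a lengths_def)
  obtain Z0 where Z0: "set_mset Z0 \<subseteq> atoms ?H" "sum_mset Z0 = a" "size Z0 = l"
    using l by (auto simp: a lengths_def)
  \<comment> \<open>The factorization \<open>Z0\<close> of length \<open>l\<close> limits the number
    of factors \<open>{#0#}\<close> in \<open>Z\<close>; these must be excluded, as the exchange
    needs another atom.\<close>
  have "count Z {#0#} = count Z0 {#0#}"
    using count_zero_sum_atoms [OF Z(1)] count_zero_sum_atoms [OF Z0(1)] Z(2) Z0(2) by simp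
  also have "\<dots> \<le> l"
    using count_le_size [of Z0 "{#0#}"] Z0(3) by simp
  finally have zeros: "count Z {#0#} \<le> l" .
  have "\<exists>A. A \<noteq> {#0#} \<and> count Z A \<ge> 2 * ?N"
  proof (rule ccontr)
    assume few: "\<not> ?thesis"
    let ?Z = "filter_mset (\<lambda>A. A \<noteq> {#0#}) Z"
    have "size ?Z \<le> card (atoms ?H) * (2 * ?N)"
      by (rule size_le_card_times [OF finite_atoms [OF card]])
        (use Z(1) few in \<open>auto simp: not_le intro: less_imp_le\<close>)
    moreover have "size Z = size ?Z + count Z {#0#}"
      using multiset_partition [of Z "\<lambda>A. A \<noteq> {#0#}"]
      by (metis (mono_tags, lifting) filter_eq_replicate_mset filter_mset_cong0 size_replicate_mset size_union)
    moreover have "K \<le> K * d" using \<open>d > 0\<close> by simp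
    ultimately show False
      using zeros Z(3) unfolding K_def by linarith
  qed
  then obtain A where A: "A \<noteq> {#0#}" "count Z A \<ge> 2 * ?N" by blast
  obtain r n where r: "r \<in> L" "r + n \<in> L" "odd n" "size Z \<le> r + ?N" "r + n \<le> size Z + M"
    using odd_length_change [OF odd card Z(1) A(2,1)] unfolding M_def a Z(2) by metis
  have "K \<le> K * d" "M \<le> M * d"
    using \<open>d > 0\<close> by simp_all
  moreover have "?N \<le> K"
    by (simp add: K_def)
  ultimately have "l \<le> r" "r + n \<le> l + (K + M) * d"
    using r(4,5) Z(3) unfolding add_mult_distrib by linarith+
  \<comment> \<open>Both lengths lie in the window, hence on the progression, so their odd
    difference would be a multiple of the even \<open>d\<close>.\<close>
  then have "r \<in> L \<inter> {l..l + (K + M) * d}" "r + n \<in> L \<inter> {l..l + (K + M) * d}"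
    using r by auto
  then obtain i j where "r = l + i * d" "r + n = l + j * d"
    unfolding AP by blast
  then have "i * d + n = j * d"
    by simp
  then have "even (i * d + n)"
    using \<open>even d\<close> by simp
  then show False
    using \<open>even d\<close> \<open>odd n\<close> by simp
qed

theorem theorem4p18:
  fixes H :: "'g::{finite, ab_group_add} multiset set"
  assumes "CARD('g) \<ge> 5"
    and "H = B_pm (UNIV :: 'g set)"
  shows "(even CARD('g) \<longleftrightarrow> (\<exists>d\<in>Delta_star H. even d)) \<and>
         ((\<exists>d\<in>Delta_star H. even d) \<longleftrightarrow> (\<exists>d\<in>Delta_one H. even d))"
proof -
  \<comment> \<open>The implications form a cycle from (1) to (2) to (3) and back, the last one by
    contraposition.\<close>
  have "even CARD('g) \<Longrightarrow> \<exists>d\<in>Delta_star H. even d"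
    using even_Delta_star_if_even_CARD assms by blast
  moreover have "Delta_star H \<subseteq> Delta_one H"
    unfolding assms(2) by (rule Delta_star_subset_Delta_one [OF submonoid_B_pm])
  moreover have "even CARD('g)" if "d \<in> Delta_one H" "even d" for d
    using odd_Delta_one [of d, where 'g = 'g] that assms by auto
  ultimately show ?thesis by blast
qed

end
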